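(* Let $\tau\le 0$ and let $\Omega\subset\mathbf{R}^n$ be an open subset. Let $f:\mathbf{R}\to\mathbf{R}_+$ be a positive function such that $$s^{\frac{\tau}{\tau-1}}f(s)^{\frac{1}{1-\tau}}\ge C_0\quad\text{for all } s>0$$ for some constant $C_0>0$. Let $u\in C^0(\Omega)$ be a positive weak solution of $\Delta u=f(u)$ in $\Omega$. Then there is an absolute constant $C(n,\tau)>0$ such that for any $R>0$ and $x_0\in\Omega$ with $B_R(x_0)\subset\Omega$, $$\int_{B_R(x_0)}u\;\ge\; C(n,\tau)\,R^{\,n+\frac{2}{1-\tau}}.$$
   Context: $B_R(x_0)$ is the ball of radius $R$ centered at $x_0$. $\mathbf{R}_+$ denotes the positive reals. The constant $C_0$ in the hypothesis on $f$ is regarded as fixed. *)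

theory Defs
  imports "HOL-Analysis.Analysis"
begin

definition partial :: "'n::finite \<Rightarrow> (real^'n \<Rightarrow> real) \<Rightarrow> real^'n \<Rightarrow> real" where
  "partial i f x = frechet_derivative f (at x) (axis i 1)"

primrec C_k :: "nat \<Rightarrow> (real^'n::finite \<Rightarrow> real) \<Rightarrow> bool" where
  "C_k 0 f \<longleftrightarrow> continuous_on UNIV f"
| "C_k (Suc k) f \<longleftrightarrow> (\<forall>x. f differentiable (at x)) \<and> (\<forall>i. C_k k (partial i f))"

definition laplacian :: "(real^'n::finite \<Rightarrow> real) \<Rightarrow> real^'n \<Rightarrow> real" where
  "laplacian f x = (\<Sum>i\<in>UNIV. partial i (partial i f) x)"

text \<open>The functions in \<open>C\<^sub>c\<^sup>\<infinity>(\<Omega>)\<close>, extended by zero to the whole space.\<close>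

definition test_function :: "(real^'n::finite) set \<Rightarrow> (real^'n \<Rightarrow> real) \<Rightarrow> bool" where
  "test_function \<Omega> \<phi> \<longleftrightarrow>
     (\<forall>k. C_k k \<phi>) \<and> compact (closure {x. \<phi> x \<noteq> 0}) \<and> closure {x. \<phi> x \<noteq> 0} \<subseteq> \<Omega>"

definition locally_integrable_on ::
    "(real^'n::finite \<Rightarrow> real) \<Rightarrow> (real^'n) set \<Rightarrow> bool" (infixr "locally'_integrable'_on" 46) where
  "g locally_integrable_on \<Omega> \<longleftrightarrow> (\<forall>K. compact K \<and> K \<subseteq> \<Omega> \<longrightarrow> set_integrable lebesgue K g)"

text \<open>Weak (distributional) solutions of \<open>\<Delta>u = g\<close> in \<open>\<Omega>\<close>. Local integrability has to be required
  explicitly, since the Bochner integral of a non-integrable function is \<open>0\<close>.\<close>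

definition weak_solution ::
    "(real^'n::finite) set \<Rightarrow> (real^'n \<Rightarrow> real) \<Rightarrow> (real^'n \<Rightarrow> real) \<Rightarrow> bool" where
  "weak_solution \<Omega> u g \<longleftrightarrow>
     u locally_integrable_on \<Omega> \<and> g locally_integrable_on \<Omega> \<and>
     (\<forall>\<phi>. test_function \<Omega> \<phi> \<longrightarrow>
        (LINT x:\<Omega>|lebesgue. u x * laplacian \<phi> x) = (LINT x:\<Omega>|lebesgue. g x * \<phi> x))"

end

theory Submission
  imports Defs "HOL-Computational_Algebra.Polynomial"
begin

text \<open>
  The hypothesis on \<open>f\<close> says that \<open>f s \<ge> c s\<^sup>\<tau>\<close> for \<open>s > 0\<close>, where \<open>c\<close> is \<open>C\<^sub>0\<close> to the power
  \<open>1 - \<tau>\<close> (\<open>power_lower_bound\<close>). Because \<open>\<tau> \<le> 0\<close>, this bound does not decay as \<open>s\<close> tends to \<open>0\<close>, so a solution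
  cannot stay small on a whole ball; testing the equation with one bump function makes this
  quantitative.

  Fix a bump \<open>\<eta>\<close> in the unit ball, with \<open>0 \<le> \<eta> \<le> 1\<close> and \<open>\<bar>\<Delta>\<eta>\<bar> \<le> M\<close>, and move it to the ball \<open>B\<close> of radius \<open>R\<close>
  about \<open>x\<^sub>0\<close> by \<open>\<phi> x = \<eta> ((x - x\<^sub>0) / R)\<close>. Then \<open>\<bar>\<Delta>\<phi>\<bar> \<le> M / R\<^sup>2\<close>, and \<open>\<integral>\<phi> \<ge> m R\<^sup>n\<close> with \<open>m > 0\<close>
  depending only on the dimension. The power \<open>s\<^sup>\<tau>\<close> lies above the affine function
  \<open>l\<^sup>\<tau> - l\<^sup>\<tau>\<^sup>-\<^sup>1 s\<close> for every \<open>l > 0\<close> (\<open>powr_nonpos_ge\<close>), so the equation tested with \<open>\<phi>\<close> gives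
  \<open>c l\<^sup>\<tau> \<integral>\<phi> \<le> (M / R\<^sup>2 + c l\<^sup>\<tau>\<^sup>-\<^sup>1) \<integral>u\<close>, the last integral being over the support of \<open>\<phi>\<close>
  (\<open>weak_solution_test\<close>). The choice \<open>l = R\<^bsup>2/(1-\<tau>)\<^esup>\<close> makes \<open>l\<^sup>\<tau>\<^sup>-\<^sup>1\<close> equal to \<open>1 / R\<^sup>2\<close>: the two terms
  on the right scale alike and the inequality becomes \<open>\<integral>u \<ge> c m / (M + c) R\<^sup>n l\<close>.

  The analytic work is in producing \<open>\<eta>\<close>, a function all of whose iterated partial derivatives exist.
  It is \<open>exp (- 1 / (1/2 - \<bar>x\<bar>\<^sup>2))\<close>, cut off by \<open>0\<close>; smoothness holds because it belongs to a class of
  differentiable functions that is closed under partial derivatives.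
\<close>

section \<open>Functions that are flat at the origin\<close>

text \<open>The derivatives of \<open>t \<mapsto> exp (- 1 / t)\<close> are polynomials in \<open>1 / t\<close> times that function; the
  polynomial parameter makes the family closed under differentiation.\<close>

definition flat :: "real poly \<Rightarrow> real \<Rightarrow> real" where
  "flat p t = (if t \<le> 0 then 0 else poly p (1 / t) * exp (- (1 / t)))"

lemma poly_times_exp_minus_tendsto_0:
  "((\<lambda>s. poly p s * exp (- s)) \<longlongrightarrow> (0::real)) at_top"
proof -
  have "((\<lambda>s. \<Sum>i\<le>degree p. coeff p i * (s ^ i / exp s)) \<longlongrightarrow> (\<Sum>i\<le>degree p. coeff p i * 0)) at_top"
    by (intro tendsto_intros tendsto_power_div_exp_0)
  moreover have "(\<lambda>s. \<Sum>i\<le>degree p. coeff p i * (s ^ i / exp s)) = (\<lambda>s. poly p s * exp (- s))"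
    by (rule ext) (simp add: poly_altdef exp_minus sum_distrib_right divide_inverse mult.assoc)
  ultimately show ?thesis by simp
qed

lemma flat_tendsto_0: "(flat p \<longlongrightarrow> 0) (at 0)"
proof -
  have "((\<lambda>t. poly p (1/t) * exp (- (1/t))) \<longlongrightarrow> 0) (at_right 0)"
    using filterlim_compose[OF poly_times_exp_minus_tendsto_0 filterlim_inverse_at_top_right, of p]
    by (simp add: divide_inverse)
  then have R: "(flat p \<longlongrightarrow> 0) (at_right 0)"
    by (rule Lim_transform_eventually)
       (auto simp: flat_def eventually_at_filter)
  have "(flat p \<longlongrightarrow> 0) (at_left 0)"
    by (rule Lim_transform_eventually[OF tendsto_const])
       (auto simp: flat_def eventually_at_filter)
  with R show ?thesis by (simp add: filterlim_split_at)
qed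

text \<open>For \<open>t > 0\<close> put \<open>s = 1 / t\<close>: since \<open>ds/dt = - s\<^sup>2\<close>, the derivative of \<open>p(s) exp(- s)\<close> is
  \<open>s\<^sup>2 (p(s) - p'(s)) exp(- s)\<close>. Hence \<open>flat p\<close> is infinitely differentiable, also at \<open>0\<close>.\<close>

lemma flat_has_derivative:
  "(flat p has_real_derivative flat ([:0,0,1:] * (p - pderiv p)) t) (at t)"
proof -
  consider "t < 0" | "t = 0" | "t > 0" by linarith
  then show ?thesis
  proof cases
    case 1
    have "((\<lambda>_. 0) has_real_derivative 0) (at t)" by simp
    then have "(flat p has_real_derivative 0) (at t)"
      by (rule has_field_derivative_transform_within_open[where S="{..<0}"])
         (use 1 in \<open>auto simp: flat_def\<close>)
    with 1 show ?thesis by (simp add: flat_def)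
  next
    case 2
    \<comment> \<open>The difference quotient at the origin is again a flat function.\<close>
    have "(\<lambda>h. (flat p (0 + h) - flat p 0) / h) = flat ([:0,1:] * p)"
      by (rule ext) (auto simp: flat_def)
    with flat_tendsto_0[of "[:0,1:] * p"] show ?thesis
      using 2 by (simp add: DERIV_def flat_def)
  next
    case 3
    have "((\<lambda>t. poly p (1/t) * exp (- (1/t))) has_real_derivative
            flat ([:0,0,1:] * (p - pderiv p)) t) (at t)"
      using 3
      by (auto intro!: derivative_eq_intros DERIV_chain2[OF poly_DERIV]
          simp: flat_def field_simps power2_eq_square)
    then show ?thesis
      by (rule has_field_derivative_transform_within_open[where S="{0<..}"])
         (use 3 in \<open>auto simp: flat_def\<close>)
  qed
qed

section \<open>Test functions\<close>

lemma partial_eqI: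
  assumes "\<And>x. (f has_derivative D x) (at x)"
  shows "partial i f = (\<lambda>x. D x (axis i 1))"
  using frechet_derivative_at[OF assms] by (auto simp: partial_def fun_eq_iff)

text \<open>The algebra generated by the coordinates and the functions \<open>flat p\<close> of \<open>1/2 - \<bar>x\<bar>\<^sup>2\<close>. Partial
  derivatives stay inside it, so induction on the order of differentiation shows that all its
  members are smooth, with no general calculus of smooth functions.\<close>

inductive bump_algebra :: "(real^'n::finite \<Rightarrow> real) \<Rightarrow> bool" where
  const: "bump_algebra (\<lambda>x. c)"
| coord: "bump_algebra (\<lambda>x. x $ i)"
| flat: "bump_algebra (\<lambda>x. flat p (1/2 - x \<bullet> x))"
| add: "bump_algebra f \<Longrightarrow> bump_algebra g \<Longrightarrow> bump_algebra (\<lambda>x. f x + g x)"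
| mult: "bump_algebra f \<Longrightarrow> bump_algebra g \<Longrightarrow> bump_algebra (\<lambda>x. f x * g x)"

lemma bump_algebra_partial:
  assumes "bump_algebra (f :: real^'n::finite \<Rightarrow> real)"
  shows "(\<forall>x. f differentiable (at x)) \<and> (\<forall>i. bump_algebra (partial i f))"
  using assms
proof induction
  case (const c)
  have D: "((\<lambda>x::real^'n. c) has_derivative (\<lambda>h. 0)) (at x)" for x by simp
  then show ?case by (auto simp: partial_eqI[OF D] bump_algebra.const)
next
  case (coord j)
  have D: "((\<lambda>x::real^'n. x $ j) has_derivative (\<lambda>h. h $ j)) (at x)" for x
    by (rule bounded_linear_imp_has_derivative) (rule bounded_linear_vec_nth)
  then show ?case
    by (auto simp: partial_eqI[OF D] differentiable_def intro: bump_algebra.const)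
next
  case (flat p)
  let ?p = "[:0,0,1:] * (p - pderiv p)"
  have D: "((\<lambda>x::real^'n. flat p (1/2 - x \<bullet> x)) has_derivative
            (\<lambda>h. flat ?p (1/2 - x \<bullet> x) * (- 2 * (x \<bullet> h)))) (at x)" for x
  proof -
    have "((\<lambda>x::real^'n. 1/2 - x \<bullet> x) has_derivative (\<lambda>h. - 2 * (x \<bullet> h))) (at x)"
      by (auto intro!: derivative_eq_intros simp: inner_commute)
    from has_derivative_compose[OF this,
        OF flat_has_derivative[unfolded has_field_derivative_def, of p]]
    show ?thesis .
  qed
  have "partial i (\<lambda>x::real^'n. flat p (1/2 - x \<bullet> x))
        = (\<lambda>x. flat ?p (1/2 - x \<bullet> x) * (- 2 * x $ i))" for i
    unfolding partial_eqI[OF D] by (simp add: inner_axis)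
  moreover have "bump_algebra (\<lambda>x::real^'n. flat ?p (1/2 - x \<bullet> x) * (- 2 * x $ i))" for i
    by (intro bump_algebra.intros)
  ultimately show ?case using D by (auto simp: differentiable_def)
next
  case (add f g)
  have D: "((\<lambda>x. f x + g x) has_derivative
             (\<lambda>h. frechet_derivative f (at x) h + frechet_derivative g (at x) h)) (at x)" for x
    using add.IH by (intro has_derivative_add) (auto simp: frechet_derivative_works)
  have "partial i (\<lambda>x. f x + g x) = (\<lambda>x. partial i f x + partial i g x)" for i
    unfolding partial_eqI[OF D] by (simp add: partial_def)
  then show ?case using add.IH D
    by (auto simp: differentiable_def intro!: bump_algebra.add)
next
  case (mult f g)
  have D: "((\<lambda>x. f x * g x) has_derivative
             (\<lambda>h. f x * frechet_derivative g (at x) h + frechet_derivative f (at x) h * g x)) (at x)" for x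
    using mult.IH by (intro has_derivative_mult) (auto simp: frechet_derivative_works)
  have "partial i (\<lambda>x. f x * g x) = (\<lambda>x. f x * partial i g x + partial i f x * g x)" for i
    unfolding partial_eqI[OF D] by (simp add: partial_def)
  then show ?case using mult D
    by (auto simp: differentiable_def intro!: bump_algebra.add bump_algebra.mult)
qed

lemma bump_algebra_C_k: "bump_algebra f \<Longrightarrow> C_k k f"
proof (induction k arbitrary: f)
  case 0
  then show ?case
    by (auto simp: bump_algebra_partial intro!: continuous_at_imp_continuous_on
        differentiable_imp_continuous_within)
next
  case (Suc k)
  then show ?case using bump_algebra_partial[of f] by simp
qed

text \<open>The witness is supported in the closed ball of radius \<open>sqrt (1/2) < 1\<close>. On the ball of radius
  \<open>1/2\<close> the argument \<open>1/2 - \<bar>x\<bar>\<^sup>2\<close> is at least \<open>1/4\<close>, which gives the value \<open>exp (- 4)\<close>.\<close>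

lemma bump_exists:
  "\<exists>\<eta>::real^'n::finite \<Rightarrow> real. test_function (ball 0 1) \<eta> \<and> (\<forall>x. 0 \<le> \<eta> x \<and> \<eta> x \<le> 1)
     \<and> (\<forall>x\<in>ball 0 (1/2). exp (-4) \<le> \<eta> x)"
proof -
  let ?\<eta> = "\<lambda>x::real^'n. flat 1 (1/2 - x \<bullet> x)"
  have supp: "{x. ?\<eta> x \<noteq> 0} \<subseteq> cball 0 (sqrt (1/2))"
    by (auto simp: flat_def norm_eq_sqrt_inner simp del: real_sqrt_divide split: if_splits)
  have cl: "closure {x. ?\<eta> x \<noteq> 0} \<subseteq> cball 0 (sqrt (1/2))"
    using supp by (rule closure_minimal) simp
  have "sqrt (1/2) < (1::real)" by (subst real_sqrt_lt_1_iff) simp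
  then have "cball 0 (sqrt (1/2)) \<subseteq> (ball 0 1 :: (real^'n) set)"
    by (simp add: cball_subset_ball_iff del: real_sqrt_divide)
  moreover have "bounded {x. ?\<eta> x \<noteq> 0}" using supp bounded_cball bounded_subset by blast
  ultimately have "test_function (ball 0 1) ?\<eta>"
    using cl by (auto simp: test_function_def bump_algebra_C_k bump_algebra.flat compact_closure)
  moreover have "0 \<le> ?\<eta> x \<and> ?\<eta> x \<le> 1" for x
    by (auto simp: flat_def)
  moreover have "exp (-4) \<le> ?\<eta> x" if "x \<in> ball 0 (1/2)" for x
  proof -
    have "x \<bullet> x \<le> (1/2)^2"
      using that by (subst power2_norm_eq_inner[symmetric], intro power_mono) auto
    then have q: "1/2 - x \<bullet> x \<ge> 1/4" by (simp add: power2_eq_square)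
    then have "1 / (1/2 - x \<bullet> x) \<le> 1 / (1/4)" by (intro divide_left_mono) auto
    with q show ?thesis by (simp add: flat_def)
  qed
  ultimately show ?thesis by blast
qed

lemma has_derivative_rescale:
  fixes f :: "real^'n::finite \<Rightarrow> real"
  assumes "\<And>x. f differentiable (at x)"
  shows "((\<lambda>x. c * f (r *\<^sub>R (x - a))) has_derivative
          (\<lambda>h. c * (r * frechet_derivative f (at (r *\<^sub>R (x - a))) h))) (at x)"
proof -
  have f: "(f has_derivative frechet_derivative f (at y)) (at y)" for y
    using assms by (simp add: frechet_derivative_works)
  have "((\<lambda>x. r *\<^sub>R (x - a)) has_derivative (\<lambda>h. r *\<^sub>R h)) (at x)"
    by (auto intro!: derivative_eq_intros)
  from has_derivative_mult_right[OF has_derivative_compose[OF this f]]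
  show ?thesis
    by (simp add: linear_cmul[OF linear_frechet_derivative[OF assms]])
qed

lemma partial_rescale:
  fixes f :: "real^'n::finite \<Rightarrow> real"
  assumes "\<And>x. f differentiable (at x)"
  shows "partial i (\<lambda>x. c * f (r *\<^sub>R (x - a))) = (\<lambda>x. (c * r) * partial i f (r *\<^sub>R (x - a)))"
  by (subst partial_eqI[OF has_derivative_rescale[OF assms]]) (simp add: partial_def mult.assoc)

text \<open>The factor \<open>c\<close> makes the induction work: each derivative brings out one more \<open>r\<close>.\<close>

lemma C_k_rescale: "C_k k f \<Longrightarrow> C_k k (\<lambda>x. c * f (r *\<^sub>R (x - a)))"
proof (induction k arbitrary: f c)
  case 0
  then show ?case
    by (auto intro!: continuous_intros continuous_on_compose2[of UNIV f])
next
  case (Suc k)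
  then have "\<And>x. f differentiable (at x)" by simp
  with Suc show ?case
    using has_derivative_rescale[of f c r a]
    by (auto simp: partial_rescale differentiable_def)
qed

lemma laplacian_rescale:
  assumes "C_k 2 f"
  shows "laplacian (\<lambda>x. f (r *\<^sub>R (x - a))) x = r\<^sup>2 * laplacian f (r *\<^sub>R (x - a))"
proof -
  have d: "\<And>x. f differentiable (at x)" "\<And>i x. partial i f differentiable (at x)"
    using assms by (auto simp: numeral_2_eq_2)
  show ?thesis
    unfolding laplacian_def
    using partial_rescale[OF d(1), where c=1 and r=r and a=a]
      partial_rescale[OF d(2), where c=r and r=r and a=a]
    by (simp add: power2_eq_square sum_distrib_left)
qed

lemma test_function_rescale:
  fixes \<eta> :: "real^'n::finite \<Rightarrow> real"
  assumes "test_function (ball 0 1) \<eta>" "R > 0"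
  shows "test_function (ball a R) (\<lambda>x. \<eta> ((1/R) *\<^sub>R (x - a)))"
proof -
  have "{x. \<eta> ((1/R) *\<^sub>R (x - a)) \<noteq> 0} = (+) a ` (*\<^sub>R) R ` {x. \<eta> x \<noteq> 0}"
  proof (intro equalityI subsetI)
    fix x assume "x \<in> {x. \<eta> ((1/R) *\<^sub>R (x - a)) \<noteq> 0}"
    moreover have "x = a + R *\<^sub>R ((1/R) *\<^sub>R (x - a))" using assms(2) by simp
    ultimately show "x \<in> (+) a ` (*\<^sub>R) R ` {x. \<eta> x \<noteq> 0}" by blast
  qed (use assms(2) in auto)
  then have cl: "closure {x. \<eta> ((1/R) *\<^sub>R (x - a)) \<noteq> 0} = (+) a ` (*\<^sub>R) R ` closure {x. \<eta> x \<noteq> 0}"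
    by (simp add: closure_translation closure_scaleR)
  have "(+) a ` (*\<^sub>R) R ` closure {x. \<eta> x \<noteq> 0} \<subseteq> (+) a ` (*\<^sub>R) R ` ball 0 1"
    using assms(1) by (intro image_mono) (auto simp: test_function_def)
  also have "\<dots> \<subseteq> ball a R"
    using assms(2) by (auto simp: dist_norm)
  finally show ?thesis
    using assms(1) C_k_rescale[of _ \<eta> 1 "1/R" a] unfolding test_function_def cl
    by (auto intro!: compact_translation compact_scaling)
qed

lemma partial_eq_0_on_open:
  assumes "open S" "\<And>x. x \<in> S \<Longrightarrow> f x = 0" "x \<in> S"
  shows "partial i f x = 0"
proof -
  have "(f has_derivative (\<lambda>h. 0)) (at x)"
    by (rule has_derivative_transform_within_open[OF has_derivative_const[of 0] assms(1,3)])
       (simp add: assms(2))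
  from frechet_derivative_at[OF this, symmetric] show ?thesis by (simp only: partial_def)
qed

lemma eq_0_off_support: "x \<notin> closure {x. \<phi> x \<noteq> 0} \<Longrightarrow> \<phi> x = 0"
  using closure_subset[of "{x. \<phi> x \<noteq> 0}"] by blast

lemma laplacian_eq_0_off_support:
  assumes "x \<notin> closure {x. \<phi> x \<noteq> 0}"
  shows "laplacian \<phi> x = 0"
proof -
  let ?S = "- closure {x. \<phi> x \<noteq> 0}"
  have 0: "\<phi> y = 0" if "y \<in> ?S" for y
    using that eq_0_off_support[of y \<phi>] by simp
  have "partial i \<phi> y = 0" if "y \<in> ?S" for y i
    by (rule partial_eq_0_on_open[OF _ 0 that]) auto
  then have "partial i (partial i \<phi>) x = 0" for i
    by (rule partial_eq_0_on_open[where S="?S", rotated]) (use assms in auto)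
  then show ?thesis by (simp add: laplacian_def)
qed

lemma test_function_continuous: "test_function \<Omega> \<phi> \<Longrightarrow> continuous_on UNIV \<phi>"
  unfolding test_function_def by (metis C_k.simps(1))

lemma laplacian_continuous: "C_k 2 \<phi> \<Longrightarrow> continuous_on UNIV (laplacian \<phi>)"
  unfolding laplacian_def by (auto simp: numeral_2_eq_2 intro!: continuous_on_sum)

lemma laplacian_bounded:
  assumes "test_function \<Omega> \<phi>"
  obtains M where "M > 0" "\<And>x. \<bar>laplacian \<phi> x\<bar> \<le> M"
proof -
  have "C_k 2 \<phi>" using assms by (simp add: test_function_def)
  then have "compact (laplacian \<phi> ` closure {x. \<phi> x \<noteq> 0})"
    using assms laplacian_continuous
    by (intro compact_continuous_image) (auto simp: test_function_def intro: continuous_on_subset)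
  then obtain M where M: "M > 0" "\<And>x. x \<in> closure {x. \<phi> x \<noteq> 0} \<Longrightarrow> \<bar>laplacian \<phi> x\<bar> \<le> M"
    using compact_imp_bounded bounded_pos by (metis imageI real_norm_def)
  show ?thesis
  proof (rule that[OF M(1)])
    show "\<bar>laplacian \<phi> x\<bar> \<le> M" for x
      using M laplacian_eq_0_off_support[of x \<phi>] by (cases "x \<in> closure {x. \<phi> x \<noteq> 0}") auto
  qed
qed

section \<open>Testing the equation\<close>

lemma set_integrable_times_bounded:
  fixes g h :: "real^'n::finite \<Rightarrow> real"
  assumes "set_integrable lebesgue K g" "continuous_on UNIV h" "\<And>x. \<bar>h x\<bar> \<le> A"
  shows "set_integrable lebesgue K (\<lambda>x. g x * h x)"
proof -
  have h: "h \<in> borel_measurable lebesgue"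
    using borel_measurable_continuous_onI[OF assms(2)]
    by (simp add: measurable_completion)
  have g: "integrable lebesgue (\<lambda>x. indicator K x * g x)"
    using assms(1) by (simp add: set_integrable_def)
  have "integrable lebesgue (\<lambda>x. (indicator K x * g x) * h x)"
  proof (rule Bochner_Integration.integrable_bound)
    show "integrable lebesgue (\<lambda>x. A * (indicator K x * g x))" using g by simp
    show "(\<lambda>x. (indicator K x * g x) * h x) \<in> borel_measurable lebesgue"
      by (rule borel_measurable_times[OF borel_measurable_integrable[OF g] h])
    have "\<bar>h x\<bar> \<le> \<bar>A\<bar>" for x using assms(3)[of x] by linarith
    then show "AE x in lebesgue. norm ((indicator K x * g x) * h x) \<le> norm (A * (indicator K x * g x))"
      by (intro AE_I2) (simp add: abs_mult mult.commute[of _ "\<bar>h _\<bar>"] mult_right_mono)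
  qed
  then show ?thesis by (simp add: set_integrable_def mult.assoc)
qed

lemma test_function_integrable:
  fixes \<phi> :: "real^'n::finite \<Rightarrow> real"
  assumes t: "test_function \<Omega> \<phi>" and b: "\<And>x. \<bar>\<phi> x\<bar> \<le> A"
  shows "set_integrable lebesgue (closure {x. \<phi> x \<noteq> 0}) \<phi>"
    and "integrable lebesgue \<phi>"
    and "(LINT x:closure {x. \<phi> x \<noteq> 0}|lebesgue. \<phi> x) = integral\<^sup>L lebesgue \<phi>"
proof -
  let ?K = "closure {x. \<phi> x \<noteq> 0}"
  have K: "compact ?K" using t by (simp add: test_function_def)
  then have "emeasure lebesgue ?K < \<infinity>" using emeasure_compact_finite[of ?K] by simp
  then have "set_integrable lebesgue ?K (\<lambda>x. 1 :: real)"
    using K unfolding set_integrable_def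
    by (auto intro!: integrable_real_indicator simp: compact_imp_closed)
  from set_integrable_times_bounded[OF this test_function_continuous[OF t] b]
  show K\<phi>: "set_integrable lebesgue ?K \<phi>" by simp
  have "indicator ?K x *\<^sub>R \<phi> x = \<phi> x" for x
  proof (cases "x \<in> ?K")
    case False
    show ?thesis unfolding eq_0_off_support[OF False] by simp
  qed simp
  with K\<phi> show "integrable lebesgue \<phi>" "(LINT x:?K|lebesgue. \<phi> x) = integral\<^sup>L lebesgue \<phi>"
    by (simp_all only: set_integrable_def set_lebesgue_integral_def)
qed

lemma set_integral_eq_subset:
  fixes h :: "'a \<Rightarrow> real"
  assumes "K \<subseteq> \<Omega>" "\<And>x. x \<notin> K \<Longrightarrow> h x = 0"
  shows "(LINT x:\<Omega>|M. h x) = (LINT x:K|M. h x)"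
  unfolding set_lebesgue_integral_def
  by (rule Bochner_Integration.integral_cong) (use assms in \<open>auto simp: indicator_def\<close>)

text \<open>With \<open>0 \<le> \<phi> \<le> 1\<close> and \<open>u \<ge> 0\<close>, an affine lower bound \<open>g \<ge> a - b u\<close> gives
  \<open>a \<phi> - b u \<le> g \<phi>\<close>, and the equation turns \<open>\<integral>g \<phi>\<close> into \<open>\<integral>u \<Delta>\<phi> \<le> M \<integral>u\<close>. An affine bound
  keeps every term linear in \<open>u\<close>. Integrals are taken over the support of \<open>\<phi>\<close>, where \<open>u\<close> and \<open>g\<close>
  are integrable; on the whole ball \<open>u\<close> may fail to be.\<close>

lemma weak_solution_test:
  fixes u g :: "real^'n::finite \<Rightarrow> real"
  assumes w: "weak_solution \<Omega> u g" and t: "test_function \<Omega> \<phi>"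
    and u: "\<And>x. x \<in> \<Omega> \<Longrightarrow> u x \<ge> 0" and \<phi>: "\<And>x. 0 \<le> \<phi> x \<and> \<phi> x \<le> 1"
    and M: "\<And>x. \<bar>laplacian \<phi> x\<bar> \<le> M"
    and g: "\<And>x. x \<in> \<Omega> \<Longrightarrow> g x \<ge> a - b * u x" and b: "b \<ge> 0"
  shows "a * integral\<^sup>L lebesgue \<phi> \<le> (M + b) * (LINT x:closure {x. \<phi> x \<noteq> 0}|lebesgue. u x)"
proof -
  let ?K = "closure {x. \<phi> x \<noteq> 0}"
  have K: "compact ?K" "?K \<subseteq> \<Omega>" using t by (auto simp: test_function_def)
  have "u locally_integrable_on \<Omega>" "g locally_integrable_on \<Omega>"
    using w by (simp_all only: weak_solution_def)
  with K have uK: "set_integrable lebesgue ?K u" and gK: "set_integrable lebesgue ?K g"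
    by (simp_all only: locally_integrable_on_def)
  have \<phi>c: "continuous_on UNIV \<phi>" using t by (rule test_function_continuous)
  have lc: "continuous_on UNIV (laplacian \<phi>)"
    using t by (auto simp: test_function_def intro: laplacian_continuous)
  have \<phi>1: "\<bar>\<phi> x\<bar> \<le> 1" for x using \<phi>[of x] by auto
  have i1: "set_integrable lebesgue ?K (\<lambda>x. u x * laplacian \<phi> x)"
    using set_integrable_times_bounded[OF uK lc M] .
  have i2: "set_integrable lebesgue ?K (\<lambda>x. g x * \<phi> x)"
    using set_integrable_times_bounded[OF gK \<phi>c \<phi>1] .
  note i3 = test_function_integrable(1)[OF t \<phi>1]
  note \<phi>K = test_function_integrable(3)[OF t \<phi>1]
  have "(LINT x:\<Omega>|lebesgue. u x * laplacian \<phi> x) = (LINT x:?K|lebesgue. u x * laplacian \<phi> x)"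
    using K(2) by (rule set_integral_eq_subset) (simp add: laplacian_eq_0_off_support)
  moreover have "(LINT x:\<Omega>|lebesgue. g x * \<phi> x) = (LINT x:?K|lebesgue. g x * \<phi> x)"
    using K(2) by (rule set_integral_eq_subset) (drule eq_0_off_support, simp)
  ultimately have eq: "(LINT x:?K|lebesgue. g x * \<phi> x) = (LINT x:?K|lebesgue. u x * laplacian \<phi> x)"
    using w t by (simp add: weak_solution_def)
  have "a * integral\<^sup>L lebesgue \<phi> - b * (LINT x:?K|lebesgue. u x)
      = (LINT x:?K|lebesgue. a * \<phi> x - b * u x)"
    using i3 uK by (simp add: \<phi>K)
  also have "\<dots> \<le> (LINT x:?K|lebesgue. g x * \<phi> x)"
  proof (rule set_integral_mono)
    show "set_integrable lebesgue ?K (\<lambda>x. a * \<phi> x - b * u x)" using i3 uK by auto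
    fix x assume "x \<in> ?K"
    then have x: "x \<in> \<Omega>" using K by auto
    have "b * u x * \<phi> x \<le> b * u x * 1"
      using b u[OF x] \<phi>[of x] by (intro mult_left_mono) auto
    moreover have "(a - b * u x) * \<phi> x \<le> g x * \<phi> x"
      using g[OF x] \<phi>[of x] by (intro mult_right_mono) auto
    ultimately show "a * \<phi> x - b * u x \<le> g x * \<phi> x" by (simp add: algebra_simps)
  qed (rule i2)
  also have "\<dots> \<le> (LINT x:?K|lebesgue. M * u x)"
    unfolding eq
  proof (rule set_integral_mono[OF i1])
    show "set_integrable lebesgue ?K (\<lambda>x. M * u x)" using uK by auto
    fix x assume "x \<in> ?K"
    then show "u x * laplacian \<phi> x \<le> M * u x"
      using mult_left_mono[of "laplacian \<phi> x" M "u x"] u K M[of x] by (auto simp: mult.commute)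
  qed
  also have "\<dots> = M * (LINT x:?K|lebesgue. u x)" by simp
  finally show ?thesis by (simp add: algebra_simps)
qed

text \<open>For \<open>s \<le> l\<close> the power is at least \<open>l\<^sup>\<tau>\<close>, and for \<open>s > l\<close> the left-hand side is negative.\<close>

lemma powr_nonpos_ge:
  fixes s l :: real
  assumes "\<tau> \<le> 0" "s > 0" "l > 0"
  shows "l powr \<tau> - l powr (\<tau> - 1) * s \<le> s powr \<tau>"
proof (cases "s \<le> l")
  case True
  then have "l powr \<tau> \<le> s powr \<tau>" using assms by (intro powr_mono2') auto
  moreover have "0 \<le> l powr (\<tau> - 1) * s" using assms by simp
  ultimately show ?thesis by linarith
next
  case False
  have "l powr \<tau> = l powr (\<tau> - 1) * l" using assms by (simp add: powr_diff)
  also have "\<dots> \<le> l powr (\<tau> - 1) * s" using False by (intro mult_left_mono) auto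
  finally show ?thesis using powr_ge_zero[of s \<tau>] by linarith
qed

lemma power_lower_bound:
  fixes s y :: real
  assumes "\<tau> \<le> 0" "C\<^sub>0 > 0" "s > 0" "y > 0"
    and h: "s powr (\<tau> / (\<tau> - 1)) * y powr (1 / (1 - \<tau>)) \<ge> C\<^sub>0"
  shows "C\<^sub>0 powr (1 - \<tau>) * s powr \<tau> \<le> y"
proof -
  have e: "\<tau> / (\<tau> - 1) * (1 - \<tau>) = - \<tau>" using assms(1) by (simp add: field_simps)
  have "C\<^sub>0 powr (1 - \<tau>) \<le> (s powr (\<tau> / (\<tau> - 1)) * y powr (1 / (1 - \<tau>))) powr (1 - \<tau>)"
    using assms by (intro powr_mono2) auto
  also have "\<dots> = s powr (- \<tau>) * y"
    using assms e by (simp add: powr_mult powr_powr)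
  finally have "C\<^sub>0 powr (1 - \<tau>) * s powr \<tau> \<le> s powr (- \<tau>) * y * s powr \<tau>"
    by (intro mult_right_mono) auto
  also have "\<dots> = y" using assms by (simp add: powr_minus field_simps)
  finally show ?thesis .
qed

lemma integral_bump_ge:
  fixes \<phi> :: "real^'n::finite \<Rightarrow> real"
  assumes t: "test_function \<Omega> \<phi>" and \<phi>: "\<And>x. 0 \<le> \<phi> x \<and> \<phi> x \<le> 1"
    and \<delta>: "\<And>x. x \<in> ball a r \<Longrightarrow> \<delta> \<le> \<phi> x" and "r \<ge> 0"
  shows "\<delta> * (unit_ball_vol (real CARD('n)) * r ^ CARD('n)) \<le> integral\<^sup>L lebesgue \<phi>"
proof -
  have "\<bar>\<phi> x\<bar> \<le> 1" for x using \<phi>[of x] by auto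
  then have i: "integrable lebesgue \<phi>" by (rule test_function_integrable(2)[OF t])
  have "\<delta> * measure lebesgue (ball a r) = (\<integral>x. \<delta> * indicator (ball a r) x \<partial>lebesgue)"
    by simp
  also have "\<dots> \<le> integral\<^sup>L lebesgue \<phi>"
  proof (rule integral_mono[OF _ i])
    show "integrable lebesgue (\<lambda>x. \<delta> * indicator (ball a r) x)"
      using emeasure_lborel_ball_finite[of a r]
      by (intro integrable_mult_right integrable_real_indicator) auto
    show "\<delta> * indicator (ball a r) x \<le> \<phi> x" for x
      using \<delta> \<phi> by (auto simp: indicator_def)
  qed
  finally show ?thesis using \<open>r \<ge> 0\<close> by (simp add: content_ball)
qed

theorem theorem3:
  fixes \<tau> C\<^sub>0 :: real
  assumes "\<tau> \<le> 0" and "C\<^sub>0 > 0"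
  shows "\<exists>C>0. \<forall>(\<Omega> :: (real^'n::finite) set) (f :: real \<Rightarrow> real) (u :: real^'n \<Rightarrow> real).
    open \<Omega> \<longrightarrow>
    (\<forall>s. f s > 0) \<longrightarrow>
    (\<forall>s>0. s powr (\<tau> / (\<tau> - 1)) * f s powr (1 / (1 - \<tau>)) \<ge> C\<^sub>0) \<longrightarrow>
    continuous_on \<Omega> u \<longrightarrow>
    (\<forall>x\<in>\<Omega>. u x > 0) \<longrightarrow>
    weak_solution \<Omega> u (\<lambda>x. f (u x)) \<longrightarrow>
    (\<forall>R>0. \<forall>x\<^sub>0\<in>\<Omega>. ball x\<^sub>0 R \<subseteq> \<Omega> \<longrightarrow>
       (\<integral>\<^sup>+x\<in>ball x\<^sub>0 R. ennreal (u x) \<partial>lebesgue)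
         \<ge> ennreal (C * R powr (real CARD('n) + 2 / (1 - \<tau>))))"
proof -
  obtain \<eta> :: "real^'n \<Rightarrow> real" where \<eta>: "test_function (ball 0 1) \<eta>" "\<And>x. 0 \<le> \<eta> x \<and> \<eta> x \<le> 1"
    "\<And>x. x \<in> ball 0 (1/2) \<Longrightarrow> exp (-4) \<le> \<eta> x"
    using bump_exists by blast
  obtain M where M: "M > 0" "\<And>x. \<bar>laplacian \<eta> x\<bar> \<le> M"
    using laplacian_bounded[OF \<eta>(1)] by blast
  define c where "c = C\<^sub>0 powr (1 - \<tau>)"
  define m where "m = exp (-4) * (unit_ball_vol (real CARD('n)) * (1/2) ^ CARD('n))"
  have c: "c > 0" using assms by (simp add: c_def)
  have m: "m > 0" by (simp add: m_def)
  show ?thesis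
  proof (intro exI[of _ "c * m / (M + c)"] conjI allI impI ballI)
    show "c * m / (M + c) > 0" using c m M by simp
  next
    fix \<Omega> :: "(real^'n) set" and f u and R :: real and x\<^sub>0
    assume f: "\<forall>s. f s > 0" "\<forall>s>0. s powr (\<tau> / (\<tau> - 1)) * f s powr (1 / (1 - \<tau>)) \<ge> C\<^sub>0"
      and u: "\<forall>x\<in>\<Omega>. u x > 0" and w: "weak_solution \<Omega> u (\<lambda>x. f (u x))"
      and R: "R > 0" and sub: "ball x\<^sub>0 R \<subseteq> \<Omega>"
    define \<phi> where "\<phi> = (\<lambda>x. \<eta> ((1/R) *\<^sub>R (x - x\<^sub>0)))"
    define l where "l = R powr (2 / (1 - \<tau>))"
    let ?K = "closure {x. \<phi> x \<noteq> 0}"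
    have t: "test_function (ball x\<^sub>0 R) \<phi>"
      unfolding \<phi>_def by (rule test_function_rescale[OF \<eta>(1) R])
    then have K: "compact ?K" "?K \<subseteq> ball x\<^sub>0 R" by (auto simp: test_function_def)
    have t\<Omega>: "test_function \<Omega> \<phi>" using t sub by (auto simp: test_function_def)
    have \<phi>: "0 \<le> \<phi> x \<and> \<phi> x \<le> 1" for x unfolding \<phi>_def by (rule \<eta>(2))
    have C2: "C_k 2 \<eta>" using \<eta>(1) by (simp add: test_function_def)
    have lap: "\<bar>laplacian \<phi> x\<bar> \<le> M / R\<^sup>2" for x
      unfolding \<phi>_def laplacian_rescale[OF C2]
      using M(2) R by (simp add: abs_mult power_one_over divide_simps)
    have l: "l > 0" using R by (simp add: l_def)
    \<comment> \<open>The zeroth-order term \<open>c l\<^sup>\<tau>\<^sup>-\<^sup>1 u\<close> thereby scales like \<open>u \<Delta>\<phi>\<close>.\<close>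
    have l1: "l powr (\<tau> - 1) = 1 / R\<^sup>2"
    proof -
      have e: "2 / (1 - \<tau>) * (\<tau> - 1) = - 2" using assms(1) by (simp add: field_simps)
      have "l powr (\<tau> - 1) = R powr (- 2)" unfolding l_def powr_powr e ..
      also have "\<dots> = 1 / R\<^sup>2" using R by (simp add: powr_minus powr_numeral divide_inverse)
      finally show ?thesis .
    qed
    have l2: "l powr \<tau> = l / R\<^sup>2"
      using l1 l by (simp add: powr_diff field_simps)
    have fu: "f (u x) \<ge> c * l powr \<tau> - c * l powr (\<tau> - 1) * u x" if "x \<in> \<Omega>" for x
    proof -
      have "c * (l powr \<tau> - l powr (\<tau> - 1) * u x) \<le> c * u x powr \<tau>"
        using powr_nonpos_ge[OF assms(1) _ l, of "u x"] u that c by (intro mult_left_mono) auto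
      also have "\<dots> \<le> f (u x)"
        unfolding c_def using power_lower_bound[OF assms, of "u x" "f (u x)"] u f that by auto
      finally show ?thesis by (simp add: algebra_simps)
    qed
    \<comment> \<open>On the concentric ball of half the radius \<open>\<phi>\<close> is at least \<open>exp (- 4)\<close>.\<close>
    have "x \<in> ball x\<^sub>0 (R/2) \<Longrightarrow> (1/R) *\<^sub>R (x - x\<^sub>0) \<in> ball 0 (1/2)" for x
      using R by (simp add: dist_norm norm_minus_commute divide_less_eq)
    then have "exp (-4) * (unit_ball_vol (real CARD('n)) * (R/2) ^ CARD('n)) \<le> integral\<^sup>L lebesgue \<phi>"
      using R \<eta>(3) by (intro integral_bump_ge[OF t \<phi>, where a=x\<^sub>0]) (auto simp: \<phi>_def)
    then have int: "m * R ^ CARD('n) \<le> integral\<^sup>L lebesgue \<phi>"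
      by (simp add: m_def power_divide mult_ac)
    have "c * l powr \<tau> * (m * R ^ CARD('n)) \<le> c * l powr \<tau> * integral\<^sup>L lebesgue \<phi>"
      using c int by (intro mult_left_mono) auto
    also have "\<dots> \<le> (M / R\<^sup>2 + c * l powr (\<tau> - 1)) * (LINT x:?K|lebesgue. u x)"
      using u c by (intro weak_solution_test[OF w t\<Omega> _ \<phi> lap fu]) (auto intro: less_imp_le)
    finally have "c * (l / R\<^sup>2) * (m * R ^ CARD('n)) \<le> (M / R\<^sup>2 + c * (1 / R\<^sup>2)) * (LINT x:?K|lebesgue. u x)"
      unfolding l1 l2 .
    then have "c * m / (M + c) * (R ^ CARD('n) * l) \<le> (LINT x:?K|lebesgue. u x)"
      using R c M(1) by (simp add: field_simps)
    moreover have "R ^ CARD('n) * l = R powr (real CARD('n) + 2 / (1 - \<tau>))"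
      using R by (simp add: l_def powr_add powr_realpow)
    ultimately have "ennreal (c * m / (M + c) * R powr (real CARD('n) + 2 / (1 - \<tau>)))
        \<le> ennreal (LINT x:?K|lebesgue. u x)"
      by (simp add: ennreal_leI)
    also have "\<dots> = (\<integral>\<^sup>+x. ennreal (indicator ?K x * u x) \<partial>lebesgue)"
    proof -
      have "set_integrable lebesgue ?K u"
        using w K sub by (auto simp: weak_solution_def locally_integrable_on_def)
      then show ?thesis
        unfolding set_lebesgue_integral_def set_integrable_def
        using K sub u
        by (subst nn_integral_eq_integral)
           (auto simp: indicator_def less_imp_le intro!: AE_I2)
    qed
    also have "\<dots> \<le> (\<integral>\<^sup>+x\<in>ball x\<^sub>0 R. ennreal (u x) \<partial>lebesgue)"
      using K by (intro nn_integral_mono) (auto simp: indicator_def)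
    finally show "ennreal (c * m / (M + c) * R powr (real CARD('n) + 2 / (1 - \<tau>)))
        \<le> (\<integral>\<^sup>+x\<in>ball x\<^sub>0 R. ennreal (u x) \<partial>lebesgue)" .
  qed
qed

end
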